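(* Under the standing assumptions in the context, let $\beta\in(0,1)$, $r\in(0,1)$ and $\lambda>0$. Set $$A:=2^r\lambda\sqrt{\frac{1}{(1-\beta)^2\tau^2}+1},\qquad k_0:=\max\Big\{\frac{2rA}{(1-\beta)\lambda\tau},\ A^{1/r}\Big(\frac{\rho G_h}{\beta\mu}\Big)^{1/(r\nu)},\ 1\Big\}.$$ Let $(x_k)_{k\ge0}$ be generated by PSGA with step-size $\alpha_k=\lambda(k+k_0)^{-r}$ and an initial point $x_0\in\mathcal{T}_\beta$ satisfying $\operatorname{dist}(x_0;\mathcal{X}^* )\le Ak_0^{-r}$. Then for all $k\ge0$ $$\operatorname{dist}(x_k;\mathcal{X}^* )\le\frac{A}{(k+k_0)^r}\qquad\text{and}\qquad f(x_k)-f^*\le\frac{LA}{(k+k_0)^r}.$$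
   Context: Notation: $\|\cdot\|$ is the Euclidean norm on $\mathbb{R}^n$, $\operatorname{dist}(x;S)=\inf_{z\in S}\|z-x\|$, $\operatorname{proj}_S(x)=\operatorname{argmin}_{z\in S}\|z-x\|$ (a set in general). $\partial f(x)$ is the Fréchet subdifferential: all $\zeta$ with $f(y)\ge f(x)+\langle\zeta,y-x\rangle+o(\|y-x\|)$ as $y\to x$. Standing assumptions: $h:\mathbb{R}^n\to\mathbb{R}\cup\{+\infty\}$ is a Legendre kernel: proper, lower semicontinuous, strictly convex, continuously differentiable on $\operatorname{int}\operatorname{dom}(h)\ne\emptyset$, and essentially smooth ($\|\nabla h(x_k)\|\to\infty$ whenever $x_k\in\operatorname{int}\operatorname{dom}(h)$ converges to a boundary point of $\operatorname{dom}(h)$). $D_h(x,y)=h(x)-h(y)-\langle\nabla h(y),x-y\rangle$ for $y\in\operatorname{int}\operatorname{dom}(h)$. $X\subseteq\operatorname{int}\operatorname{dom}(h)$ is nonempty, closed and convex. $f:\mathbb{R}^n\to\mathbb{R}\cup\{+\infty\}$ is proper (not assumed differentiable), $\rho>0$, and $f+\rho h$ is convex on $\operatorname{int}\operatorname{dom}(h)$ ($f$ is $\rho$-weakly convex relative to $h$); $f$ is finite and locally Lipschitz around every point of $X$. $f^*:=\inf_Xf>-\infty$ and $\mathcal{X}^*:=\{x\in X:f(x)=f^*\}\neq\emptyset$. Sharpness: $\mu>0$ and $\mu\operatorname{dist}(x;\mathcal{X}^* )\le f(x)-f^*$ for all $x\in X$. Local Bregman growth: $\nu\in(0,1]$, $G_h>0$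 and $\inf_{y\in\operatorname{proj}_{\mathcal{X}^*}(x)}D_h(y,x)\le G_h\operatorname{dist}^{1+\nu}(x;\mathcal{X}^* )$ for all $x\in X$ with $\operatorname{dist}(x;\mathcal{X}^* )<(\mu/(\rho G_h))^{1/\nu}$. For $\beta\in(0,1]$, $\mathcal{T}_\beta:=\{x\in X:\operatorname{dist}(x;\mathcal{X}^* )<(\beta\mu/(\rho G_h))^{1/\nu}\}$. $L:=\sup\{\|\zeta\|:\zeta\in\partial f(x),\,x\in\mathcal{T}_1\}$, assumed to satisfy $0<L<\infty$, and $\tau:=\mu/L$. PSGA (projected subgradient algorithm): given $\beta\in(0,1)$, $x_0\in\mathcal{T}_\beta$ and step-sizes $\alpha_k>0$, for $k=0,1,2,\dots$ choose any $\zeta_k\in\partial f(x_k)$ and set $x_{k+1}=\operatorname{proj}_X\big(x_k-\alpha_k\zeta_k/\|\zeta_k\|\big)$ (with $x_{k+1}=x_k$ if $\zeta_k=0$). *)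

theory Defs
  imports "HOL-Analysis.Analysis" "HOL-Library.Landau_Symbols"
begin

text \<open>
  Functions with values in \<open>\<real> \<union> {+\<infinity>}\<close> are functions into \<^typ>\<open>ereal\<close> that never take the
  value \<open>-\<infinity>\<close>; the latter is part of properness below.
\<close>

definition eff_dom :: "('a \<Rightarrow> ereal) \<Rightarrow> 'a set" where
  "eff_dom f = {x. f x < \<infinity>}"

definition proper_fun :: "('a \<Rightarrow> ereal) \<Rightarrow> bool" where
  "proper_fun f \<longleftrightarrow> (\<forall>x. f x \<noteq> -\<infinity>) \<and> eff_dom f \<noteq> {}"

definition lsc :: "('a::topological_space \<Rightarrow> ereal) \<Rightarrow> bool" where
  "lsc f \<longleftrightarrow> (\<forall>x. f x \<le> Liminf (at x) f)"

definition ereal_convex_on :: "'a::real_vector set \<Rightarrow> ('a \<Rightarrow> ereal) \<Rightarrow> bool" where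
  "ereal_convex_on S g \<longleftrightarrow> convex S \<and>
     (\<forall>x\<in>S. \<forall>y\<in>S. \<forall>t\<in>{0<..<1}.
        g ((1 - t) *\<^sub>R x + t *\<^sub>R y) \<le> ereal (1 - t) * g x + ereal t * g y)"

text \<open>The strict inequality is only meaningful at points of finite value.  It forces the effective
  domain to be convex.\<close>

definition strictly_convex :: "('a::real_vector \<Rightarrow> ereal) \<Rightarrow> bool" where
  "strictly_convex h \<longleftrightarrow>
     (\<forall>x\<in>eff_dom h. \<forall>y\<in>eff_dom h. \<forall>t\<in>{0<..<1}. x \<noteq> y \<longrightarrow>
        h ((1 - t) *\<^sub>R x + t *\<^sub>R y) < ereal (1 - t) * h x + ereal t * h y)"

text \<open>Only used at interior points of the effective domain, where \<^const>\<open>real_of_ereal\<close>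
  (which sends \<open>\<infinity>\<close> to 0) does not change the function locally.\<close>

definition grad :: "('a::real_inner \<Rightarrow> ereal) \<Rightarrow> 'a \<Rightarrow> 'a" where
  "grad h x = (THE v. GDERIV (\<lambda>z. real_of_ereal (h z)) x :> v)"

definition legendre_kernel :: "('a::euclidean_space \<Rightarrow> ereal) \<Rightarrow> bool" where
  "legendre_kernel h \<longleftrightarrow>
     proper_fun h \<and> lsc h \<and> strictly_convex h \<and>
     interior (eff_dom h) \<noteq> {} \<and>
     (\<forall>x\<in>interior (eff_dom h). \<exists>v. GDERIV (\<lambda>z. real_of_ereal (h z)) x :> v) \<and>
     continuous_on (interior (eff_dom h)) (grad h) \<and>
     (\<forall>(u :: nat \<Rightarrow> 'a) b.
        (\<forall>k. u k \<in> interior (eff_dom h)) \<and> u \<longlonglongrightarrow> b \<and> b \<in> frontier (eff_dom h) \<longrightarrow>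
        filterlim (\<lambda>k. norm (grad h (u k))) at_top sequentially)"

definition bregman :: "('a::real_inner \<Rightarrow> ereal) \<Rightarrow> 'a \<Rightarrow> 'a \<Rightarrow> ereal" where
  "bregman h x y = h x - h y - ereal (grad h y \<bullet> (x - y))"

definition proj :: "'a::real_normed_vector set \<Rightarrow> 'a \<Rightarrow> 'a set" where
  "proj S x = {z. is_arg_min (\<lambda>z. norm (z - x)) (\<lambda>z. z \<in> S) z}"

text \<open>Frechet subdifferential; empty at points where \<open>f\<close> is not finite.\<close>

definition frechet_subdiff :: "('a::real_inner \<Rightarrow> ereal) \<Rightarrow> 'a \<Rightarrow> 'a set" where
  "frechet_subdiff f x =
     {\<zeta>. \<bar>f x\<bar> \<noteq> \<infinity> \<and>
         (\<exists>e :: 'a \<Rightarrow> real. e \<in> o[at x](\<lambda>y. norm (y - x)) \<and>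
            (\<forall>\<^sub>F y in at x. f y \<ge> f x + ereal (\<zeta> \<bullet> (y - x) + e y)))}"

definition finite_locally_lipschitz_at :: "('a::metric_space \<Rightarrow> ereal) \<Rightarrow> 'a \<Rightarrow> bool" where
  "finite_locally_lipschitz_at f x \<longleftrightarrow>
     (\<exists>\<epsilon>>0. (\<forall>y\<in>ball x \<epsilon>. \<bar>f y\<bar> \<noteq> \<infinity>) \<and>
            (\<exists>C. C-lipschitz_on (ball x \<epsilon>) (\<lambda>y. real_of_ereal (f y))))"

definition opt_value :: "('a \<Rightarrow> ereal) \<Rightarrow> 'a set \<Rightarrow> ereal" where
  "opt_value f X = (INF x\<in>X. f x)"

definition opt_set :: "('a \<Rightarrow> ereal) \<Rightarrow> 'a set \<Rightarrow> 'a set" where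
  "opt_set f X = {x\<in>X. f x = opt_value f X}"

definition tube ::
  "('a::metric_space \<Rightarrow> ereal) \<Rightarrow> 'a set \<Rightarrow> real \<Rightarrow> real \<Rightarrow> real \<Rightarrow> real \<Rightarrow> real \<Rightarrow> 'a set" where
  "tube f X \<mu> \<rho> G \<nu> \<beta> =
     {x\<in>X. infdist x (opt_set f X) < (\<beta> * \<mu> / (\<rho> * G)) powr (1 / \<nu>)}"

text \<open>The iterates \<open>x\<close> of the projected subgradient algorithm with step-sizes \<open>\<alpha>\<close>, for an
  arbitrary choice of subgradients.  For closed convex nonempty \<open>X\<close> the projection onto \<open>X\<close> is
  single-valued, so membership below is the equation \<open>x\<^sub>k\<^sub>+\<^sub>1 = proj\<^sub>X(\<dots>)\<close>.\<close>

definition psga ::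
  "('a::real_inner \<Rightarrow> ereal) \<Rightarrow> 'a set \<Rightarrow> (nat \<Rightarrow> real) \<Rightarrow> (nat \<Rightarrow> 'a) \<Rightarrow> bool" where
  "psga f X \<alpha> x \<longleftrightarrow>
     (\<forall>k. \<exists>\<zeta>\<in>frechet_subdiff f (x k).
        (if \<zeta> = 0 then x (Suc k) = x k
         else x (Suc k) \<in> proj X (x k - (\<alpha> k / norm \<zeta>) *\<^sub>R \<zeta>)))"

end

theory Submission
  imports Defs
begin

text \<open>
  Comparing \<open>f\<close> on a segment with its first-order behaviour at one end, a Frechet subgradient
  \<open>\<zeta>\<close> at \<open>x\<close> satisfies \<open>f y \<ge> f x + \<zeta> \<bullet> (y - x) - \<rho> D\<^sub>h(y, x)\<close>.  With \<open>y\<close> a nearest minimizer, sharpness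
  and the growth condition give \<open>\<zeta> \<bullet> (x - y) \<ge> (1 - \<beta>) \<mu> d\<close> in the tube, where \<open>d\<close> is the distance of
  \<open>x\<close> to the minimizers; hence one step of length \<open>\<alpha>\<close> yields
  \<open>d'\<^sup>2 \<le> d\<^sup>2 - 2 \<alpha> (1 - \<beta>) \<tau> d + \<alpha>\<^sup>2\<close>.  The right-hand side is convex in \<open>d\<close>, so the rate
  \<open>A (k + k\<^sub>0)\<^sup>-\<^sup>r\<close> only has to be propagated from \<open>d = 0\<close> and from the largest admissible \<open>d\<close>; the choices
  of \<open>A\<close> and \<open>k\<^sub>0\<close> serve these two cases.
  For the function values, \<open>f\<close> has a subgradient of norm at most \<open>L\<close> at every point of the segment from
  \<open>x\<close> to a nearest minimizer, so its increase along that segment is at most \<open>L d\<close>.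
\<close>

section \<open>Projections, gradients and subgradients\<close>

lemma projD:
  assumes "z \<in> proj S x"
  shows "z \<in> S" "dist x z = infdist x S"
proof -
  show zS: "z \<in> S"
    using assms by (auto simp: proj_def is_arg_min_def)
  have le: "dist x z \<le> dist x y" if "y \<in> S" for y
    using assms that by (fastforce simp: proj_def is_arg_min_def dist_norm norm_minus_commute)
  have "dist x z \<le> infdist x S"
    using zS le by (auto simp: infdist_def intro!: cINF_greatest)
  then show "dist x z = infdist x S"
    using infdist_le[OF zS, of x] by simp
qed

lemma closest_point_in_proj:
  assumes "closed S" "S \<noteq> {}"
  shows "closest_point S x \<in> proj S x"
  using closest_point_exists[OF assms, of x]
  by (fastforce simp: proj_def is_arg_min_def dist_norm norm_minus_commute)

text \<open>The set-valued \<open>proj\<close> is identified with \<open>closest_point\<close>,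
  which is 1-Lipschitz and fixes \<open>y\<close>.\<close>

lemma proj_nonexpansive:
  fixes S :: "'a::euclidean_space set"
  assumes "convex S" "closed S" "z \<in> proj S p" "y \<in> S"
  shows "dist z y \<le> dist p y"
proof -
  have "\<forall>w\<in>S. dist p z \<le> dist p w"
    using projD[OF assms(3)] infdist_le by metis
  then have "z = closest_point S p"
    using closest_point_unique[OF assms(1,2) projD(1)[OF assms(3)]] by blast
  then show ?thesis
    using closest_point_lipschitz[OF assms(1,2), of p y] closest_point_self[OF assms(4)] assms(4)
    by auto
qed

section \<open>First-order expansions for gradients and Frechet subgradients\<close>

lemma gderiv_unique:
  assumes "GDERIV f x :> v" "GDERIV f x :> w"
  shows "v = w"
proof -
  have "(\<lambda>h. h \<bullet> v) = (\<lambda>h. h \<bullet> w)"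
    using has_derivative_unique assms unfolding gderiv_def by blast
  then show ?thesis
    by (metis vector_eq_ldot)
qed

lemma gderiv_grad:
  assumes "GDERIV (\<lambda>z. real_of_ereal (h z)) x :> v"
  shows "GDERIV (\<lambda>z. real_of_ereal (h z)) x :> grad h x"
  unfolding grad_def by (rule theI) (use assms gderiv_unique in blast)+

lemma gderiv_smallo:
  assumes "GDERIV H x :> v"
  shows "(\<lambda>y. H y - H x - v \<bullet> (y - x)) \<in> o[at x](\<lambda>y. norm (y - x))"
proof (rule smalloI_tendsto)
  have "((\<lambda>y. norm (H y - H x - v \<bullet> (y - x)) / norm (y - x)) \<longlongrightarrow> 0) (at x)"
    using assms unfolding gderiv_def has_derivative_iff_norm by (simp add: inner_commute)
  then show "((\<lambda>y. (H y - H x - v \<bullet> (y - x)) / norm (y - x)) \<longlongrightarrow> 0) (at x)"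
    by (subst tendsto_norm_zero_iff[symmetric]) simp
  show "\<forall>\<^sub>F y in at x. norm (y - x) \<noteq> 0"
    by (simp add: eventually_at_filter)
qed

text \<open>The little-o remainder is traded for an arbitrary slope \<epsilon>, the form in which a
  given subgradient is used below.\<close>

lemma frechet_subdiff_eventually:
  assumes "\<zeta> \<in> frechet_subdiff f x" "\<epsilon> > 0"
  shows "\<forall>\<^sub>F y in at x. f y \<ge> f x + ereal (\<zeta> \<bullet> (y - x) - \<epsilon> * norm (y - x))"
proof -
  obtain e where e: "e \<in> o[at x](\<lambda>y. norm (y - x))"
    and ev: "\<forall>\<^sub>F y in at x. f y \<ge> f x + ereal (\<zeta> \<bullet> (y - x) + e y)"
    using assms(1) unfolding frechet_subdiff_def by blast
  from landau_o.smallD[OF e assms(2)] ev show ?thesis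
  proof eventually_elim
    case (elim y)
    then have "ereal (\<zeta> \<bullet> (y - x) - \<epsilon> * norm (y - x)) \<le> ereal (\<zeta> \<bullet> (y - x) + e y)"
      by simp
    then show ?case
      using elim(2) by (meson add_left_mono order_trans)
  qed
qed

text \<open>A hyperplane separates the epigraph from the open ray below \<open>(z, g z)\<close>;
  openness of \<open>S\<close> keeps it from being vertical, so its normal can be rescaled to a
  slope.\<close>

lemma convex_on_subgradient:
  fixes g :: "'a::euclidean_space \<Rightarrow> real"
  assumes "convex_on S g" "open S" "z \<in> S"
  obtains v where "\<And>y. y \<in> S \<Longrightarrow> g y \<ge> g z + v \<bullet> (y - z)"
proof -
  let ?T = "{z} \<times> {..<g z}"
  have "\<exists>a b. a \<noteq> 0 \<and> (\<forall>p\<in>epigraph S g. a \<bullet> p \<le> b) \<and> (\<forall>p\<in>?T. a \<bullet> p \<ge> b)"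
  proof (rule separating_hyperplane_sets)
    show "convex (epigraph S g)"
      using assms(1) by (rule convex_epigraphI)
    show "convex ?T"
      by (intro convex_Times convex_singleton convex_real_interval)
    show "epigraph S g \<noteq> {}"
      using assms(3) by (auto simp: epigraph_def)
    show "?T \<noteq> {}"
      by auto
    show "epigraph S g \<inter> ?T = {}"
      by (auto simp: epigraph_def)
  qed
  then obtain w c b where wc: "(w, c) \<noteq> 0"
    and epi: "\<And>p. p \<in> epigraph S g \<Longrightarrow> (w, c) \<bullet> p \<le> b"
    and hypo: "\<And>p. p \<in> ?T \<Longrightarrow> (w, c) \<bullet> p \<ge> b"
    by (metis surj_pair)
  have ineq: "w \<bullet> y + c * t \<le> w \<bullet> z + c * s" if "y \<in> S" "g y \<le> t" "s < g z" for y t s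
    using epi[of "(y, t)"] hypo[of "(z, s)"] that by (simp add: mem_epigraph)
  have "c \<le> 0"
    using ineq[of z "g z + 1" "g z - 1"] assms(3) by (simp add: algebra_simps)
  moreover have "c \<noteq> 0"
  proof
    \<comment> \<open>For a vertical hyperplane, a short step from \<open>z\<close> along
      \<open>w\<close> stays in \<open>S\<close> and lands on the wrong side.\<close>
    assume c0: "c = 0"
    obtain e where "e > 0" "cball z e \<subseteq> S"
      using assms(2,3) open_contains_cball by blast
    moreover have w0: "w \<noteq> 0"
      using wc c0 by (auto simp: zero_prod_def)
    ultimately have "z + (e / norm w) *\<^sub>R w \<in> S"
      by (auto simp: dist_norm subset_iff)
    from ineq[OF this order_refl, of "g z - 1"] c0
    have "(e / norm w) * (w \<bullet> w) \<le> 0"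
      by (simp add: inner_add_right)
    moreover have "(e / norm w) * (w \<bullet> w) > 0"
      using \<open>e > 0\<close> w0 by simp
    ultimately show False by simp
  qed
  ultimately have c: "c < 0" by simp
  show thesis
  proof (rule that[of "(- 1 / c) *\<^sub>R w"])
    fix y assume y: "y \<in> S"
    have "w \<bullet> y + c * g y \<le> w \<bullet> z + c * g z"
    \<comment> \<open>The ray lies strictly below \<open>g z\<close>, so \<open>g z\<close> is
      approached through \<open>g z + e / c\<close>, which is smaller because
      \<open>c < 0\<close>.\<close>
    proof (rule field_le_epsilon)
      fix e :: real assume "e > 0"
      then show "w \<bullet> y + c * g y \<le> w \<bullet> z + c * g z + e"
        using ineq[OF y order_refl, of "g z + e / c"] c
        by (simp add: algebra_simps divide_less_0_iff)
    qed
    then show "g y \<ge> g z + ((- 1 / c) *\<^sub>R w) \<bullet> (y - z)"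
      using c by (simp add: inner_diff_right field_simps)
  qed
qed

section \<open>Relatively weakly convex functions\<close>

locale rel_weakly_convex =
  fixes h f :: "'a::euclidean_space \<Rightarrow> ereal" and X :: "'a set" and \<rho> :: real
  assumes kernel: "legendre_kernel h"
    and closed_X: "closed X" and convex_X: "convex X" and X_sub: "X \<subseteq> interior (eff_dom h)"
    and rho_pos: "\<rho> > 0"
    and wconvex: "ereal_convex_on (interior (eff_dom h)) (\<lambda>z. f z + ereal \<rho> * h z)"
    and lipschitz: "\<forall>z\<in>X. finite_locally_lipschitz_at f z"
    and opt_nonempty: "opt_set f X \<noteq> {}"
begin

section \<open>Real-valued representatives of the two functions\<close>

definition "F z = real_of_ereal (f z)"
definition "H z = real_of_ereal (h z)"

lemma h_eq: "h z = ereal (H z)" if "z \<in> interior (eff_dom h)"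
proof -
  have "h z < \<infinity>" "h z \<noteq> -\<infinity>"
    using that kernel interior_subset[of "eff_dom h"]
    by (auto simp: legendre_kernel_def proper_fun_def eff_dom_def)
  then show ?thesis
    by (cases "h z") (auto simp: H_def)
qed

lemma f_eq: "f z = ereal (F z)" if "\<bar>f z\<bar> \<noteq> \<infinity>"
  using that by (simp add: F_def ereal_real)

lemma f_eq_X: "f z = ereal (F z)" if z: "z \<in> X"
proof (rule f_eq)
  obtain \<epsilon> where "\<epsilon> > 0" "\<forall>y\<in>ball z \<epsilon>. \<bar>f y\<bar> \<noteq> \<infinity>"
    using lipschitz z unfolding finite_locally_lipschitz_at_def by blast
  then show "\<bar>f z\<bar> \<noteq> \<infinity>" by simp
qed

lemma continuous_F: "continuous_on X F"
  unfolding continuous_on_eq_continuous_within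
proof
  fix z assume z: "z \<in> X"
  then obtain \<epsilon> C where "\<epsilon> > 0" "C-lipschitz_on (ball z \<epsilon>) F"
    using lipschitz unfolding finite_locally_lipschitz_at_def F_def by blast
  then have "continuous (at z) F"
    using lipschitz_on_continuous_on continuous_on_eq_continuous_at[OF open_ball] centre_in_ball
    by metis
  then show "continuous (at z within X) F"
    by (rule continuous_at_imp_continuous_at_within)
qed

lemma opt_value_eq: "f y = opt_value f X" if "y \<in> opt_set f X"
  using that by (simp add: opt_set_def)

lemma opt_set_subset: "opt_set f X \<subseteq> X"
  by (auto simp: opt_set_def)

text \<open>The minimizers form a level set of the continuous \<open>F\<close> in the closed
  \<open>X\<close>; this is what makes a nearest minimizer exist.\<close>

lemma closed_opt_set: "closed (opt_set f X)"
proof -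
  obtain y where y: "y \<in> opt_set f X"
    using opt_nonempty by blast
  then have "opt_value f X = ereal (F y)"
    using opt_value_eq f_eq_X opt_set_subset by (metis subsetD)
  then have "opt_set f X = {z \<in> X. F z = F y}"
    using f_eq_X by (auto simp: opt_set_def)
  then show ?thesis
    using continuous_closed_preimage_constant[OF continuous_F closed_X, of "F y"] by simp
qed

lemma gderiv_H: "GDERIV H z :> grad h z" if "z \<in> interior (eff_dom h)"
proof -
  have "H = (\<lambda>z. real_of_ereal (h z))"
    by (simp add: H_def fun_eq_iff)
  then show ?thesis
    using that kernel gderiv_grad unfolding legendre_kernel_def by metis
qed

text \<open>Away from \<open>X\<close> the function \<open>f\<close> may be infinite, so passing to
  reals is tied to finiteness at the three points involved.\<close>

lemma convex_FH:
  assumes "x \<in> interior (eff_dom h)" "y \<in> interior (eff_dom h)" "0 < t" "t < 1"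
    and "\<bar>f x\<bar> \<noteq> \<infinity>" "\<bar>f y\<bar> \<noteq> \<infinity>" "\<bar>f ((1 - t) *\<^sub>R x + t *\<^sub>R y)\<bar> \<noteq> \<infinity>"
  shows "F ((1 - t) *\<^sub>R x + t *\<^sub>R y) + \<rho> * H ((1 - t) *\<^sub>R x + t *\<^sub>R y)
           \<le> (1 - t) * (F x + \<rho> * H x) + t * (F y + \<rho> * H y)"
proof -
  let ?z = "(1 - t) *\<^sub>R x + t *\<^sub>R y"
  have "?z \<in> interior (eff_dom h)"
    using wconvex assms(1-4) convexD_alt[of "interior (eff_dom h)" x y t]
    by (auto simp: ereal_convex_on_def)
  moreover have "f ?z + ereal \<rho> * h ?z
      \<le> ereal (1 - t) * (f x + ereal \<rho> * h x) + ereal t * (f y + ereal \<rho> * h y)"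
    using wconvex assms(1-4) unfolding ereal_convex_on_def by auto
  ultimately show ?thesis
    unfolding f_eq[OF assms(5)] f_eq[OF assms(6)] f_eq[OF assms(7)] h_eq[OF assms(1)] h_eq[OF assms(2)]
    by (simp add: h_eq)
qed

lemma bregman_eq:
  assumes "y \<in> interior (eff_dom h)" "x \<in> interior (eff_dom h)"
  shows "bregman h y x = ereal (H y - H x - grad h x \<bullet> (y - x))"
  using assms by (simp add: bregman_def h_eq)

text \<open>Convexity of \<open>F + \<rho> * H\<close> bounds its value at a point \<open>z\<close>
  of the segment near \<open>x\<close> from above, the expansions at \<open>x\<close> bound it from
  below; all terms beyond the value at \<open>x\<close> carry the factor \<open>t\<close>, which
  cancels.\<close>

lemma subgradient_inequality:
  assumes x: "x \<in> X" and y: "y \<in> X" and \<zeta>: "\<zeta> \<in> frechet_subdiff f x"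
  shows "F y \<ge> F x + \<zeta> \<bullet> (y - x) - \<rho> * (H y - H x - grad h x \<bullet> (y - x))"
proof (rule field_le_epsilon)
  fix e :: real assume e: "e > 0"
  show "F x + \<zeta> \<bullet> (y - x) - \<rho> * (H y - H x - grad h x \<bullet> (y - x)) \<le> F y + e"
  proof (cases "y = x")
    case False
    \<comment> \<open>The remainders of \<open>F\<close> and of \<open>\<rho> * H\<close> cost
      \<open>\<epsilon>\<close> and \<open>\<rho> * \<epsilon>\<close> per unit length, in total
      \<open>t * e\<close> at distance \<open>t * norm (y - x)\<close>.\<close>
    define \<epsilon> where "\<epsilon> = e / ((1 + \<rho>) * norm (y - x))"
    have \<epsilon>: "\<epsilon> > 0" "(1 + \<rho>) * \<epsilon> * norm (y - x) = e"
      using e rho_pos False by (auto simp: \<epsilon>_def)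
    have "GDERIV H x :> grad h x"
      using gderiv_H x X_sub by blast
    then have "\<forall>\<^sub>F z in at x. f z \<ge> f x + ereal (\<zeta> \<bullet> (z - x) - \<epsilon> * norm (z - x))
        \<and> norm (H z - H x - grad h x \<bullet> (z - x)) \<le> \<epsilon> * norm (norm (z - x))"
      by (rule eventually_conj[OF frechet_subdiff_eventually[OF \<zeta> \<epsilon>(1)]
            landau_o.smallD[OF gderiv_smallo \<epsilon>(1)]])
    then obtain d where d: "d > 0" and near: "\<And>z. z \<noteq> x \<Longrightarrow> dist z x < d \<Longrightarrow>
        f z \<ge> f x + ereal (\<zeta> \<bullet> (z - x) - \<epsilon> * norm (z - x))
        \<and> norm (H z - H x - grad h x \<bullet> (z - x)) \<le> \<epsilon> * norm (norm (z - x))"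
      unfolding eventually_at by blast
    define t where "t = min (1/2) (d / (2 * norm (y - x)))"
    define z where "z = (1 - t) *\<^sub>R x + t *\<^sub>R y"
    have t: "0 < t" "t < 1"
      using d False by (auto simp: t_def)
    have zx: "z - x = t *\<^sub>R (y - x)"
      by (simp add: z_def algebra_simps)
    have "t * norm (y - x) \<le> d / 2"
    proof -
      have "t \<le> d / (2 * norm (y - x))" by (simp add: t_def)
      then show ?thesis using False by (simp add: field_simps)
    qed
    then have "dist z x < d"
      using t d by (simp add: dist_norm zx)
    moreover have "z \<noteq> x"
      using zx t False by auto
    moreover have zX: "z \<in> X"
      unfolding z_def using convex_X x y t by (intro convexD_alt) auto
    ultimately have 1: "F z \<ge> F x + t * (\<zeta> \<bullet> (y - x)) - \<epsilon> * (t * norm (y - x))"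
      and 2: "H z \<ge> H x + t * (grad h x \<bullet> (y - x)) - \<epsilon> * (t * norm (y - x))"
      using near[of z] f_eq_X[OF x] f_eq_X[OF zX] t by (auto simp: zx abs_le_iff)
    have "F z + \<rho> * H z \<le> (1 - t) * (F x + \<rho> * H x) + t * (F y + \<rho> * H y)"
      unfolding z_def
      by (rule convex_FH) (use x y t X_sub zX f_eq_X in \<open>auto simp: z_def[symmetric]\<close>)
    moreover have "\<rho> * H z \<ge> \<rho> * (H x + t * (grad h x \<bullet> (y - x)) - \<epsilon> * (t * norm (y - x)))"
      using 2 rho_pos by simp
    ultimately have "t * (\<zeta> \<bullet> (y - x) + \<rho> * (grad h x \<bullet> (y - x)) - (1 + \<rho>) * \<epsilon> * norm (y - x))
        \<le> t * (F y + \<rho> * H y - (F x + \<rho> * H x))"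
      using 1 by (simp add: algebra_simps)
    then have "\<zeta> \<bullet> (y - x) + \<rho> * (grad h x \<bullet> (y - x)) - (1 + \<rho>) * \<epsilon> * norm (y - x)
        \<le> F y + \<rho> * H y - (F x + \<rho> * H x)"
      using t(1) by simp
    then show ?thesis
      unfolding \<epsilon>(2) by (simp add: right_diff_distrib)
  qed (use e in simp)
qed

text \<open>Near \<open>z\<close> the function \<open>F + \<rho> * H\<close> is finite and convex,
  hence has a subgradient \<open>v\<close> there; subtracting the gradient of the smooth part
  \<open>\<rho> * H\<close> leaves a Frechet subgradient of \<open>f\<close>.\<close>

lemma frechet_subdiff_nonempty:
  assumes z: "z \<in> X"
  shows "frechet_subdiff f z \<noteq> {}"
proof -
  obtain \<epsilon> where \<epsilon>: "\<epsilon> > 0" "\<forall>y\<in>ball z \<epsilon>. \<bar>f y\<bar> \<noteq> \<infinity>"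
    using lipschitz z unfolding finite_locally_lipschitz_at_def by blast
  define B where "B = ball z \<epsilon> \<inter> interior (eff_dom h)"
  have B: "open B" "convex B" "z \<in> B"
    using wconvex z X_sub \<epsilon>(1) by (auto simp: B_def ereal_convex_on_def intro!: convex_Int)
  have fin: "\<bar>f y\<bar> \<noteq> \<infinity>" "y \<in> interior (eff_dom h)" if "y \<in> B" for y
    using that \<epsilon>(2) by (auto simp: B_def)
  have "convex_on B (\<lambda>y. F y + \<rho> * H y)"
  proof (rule convex_onI)
    fix t :: real and x y assume "0 < t" "t < 1" and xy: "x \<in> B" "y \<in> B"
    moreover from this have "(1 - t) *\<^sub>R x + t *\<^sub>R y \<in> B"
      using B(2) by (intro convexD_alt) auto
    ultimately show "F ((1 - t) *\<^sub>R x + t *\<^sub>R y) + \<rho> * H ((1 - t) *\<^sub>R x + t *\<^sub>R y)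
           \<le> (1 - t) * (F x + \<rho> * H x) + t * (F y + \<rho> * H y)"
      using fin by (intro convex_FH) auto
  qed (rule B(2))
  from convex_on_subgradient[OF this B(1,3)]
  obtain v where v: "\<And>y. y \<in> B \<Longrightarrow> F y + \<rho> * H y \<ge> F z + \<rho> * H z + v \<bullet> (y - z)"
    by blast
  \<comment> \<open>The linearization error of \<open>- \<rho> * H\<close> serves as the little-o
    term.\<close>
  define e where "e y = - \<rho> * (H y - H z - grad h z \<bullet> (y - z))" for y
  have "e \<in> o[at z](\<lambda>y. norm (y - z))"
    unfolding e_def using gderiv_smallo[OF gderiv_H] z X_sub rho_pos
    by (subst landau_o.small.cmult_in_iff) auto
  moreover have "\<forall>\<^sub>F y in at z. f y \<ge> f z + ereal ((v - \<rho> *\<^sub>R grad h z) \<bullet> (y - z) + e y)"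
  proof -
    have "\<forall>\<^sub>F y in at z. y \<in> B"
      using B by (intro eventually_at_in_open') auto
    then show ?thesis
    proof eventually_elim
      case (elim y)
      then show ?case
        using v[OF elim] f_eq[OF fin(1)[OF elim]] f_eq_X[OF z]
        by (simp add: e_def algebra_simps)
    qed
  qed
  ultimately have "v - \<rho> *\<^sub>R grad h z \<in> frechet_subdiff f z"
    using f_eq_X[OF z] unfolding frechet_subdiff_def by auto
  then show ?thesis by blast
qed

text \<open>At a maximizer \<open>s > 0\<close> of the tilted function \<open>m\<close> below, a subgradient of norm at most \<open>L\<close> would
  force a larger value slightly to the left of \<open>s\<close>.\<close>

lemma increase_along_segment:
  assumes x: "x \<in> X" and y: "y \<in> X"
    and L: "\<And>w \<zeta>. w \<in> closed_segment y x \<Longrightarrow> \<zeta> \<in> frechet_subdiff f w \<Longrightarrow> norm \<zeta> \<le> L"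
  shows "F x - F y \<le> L * norm (x - y)"
proof (rule field_le_epsilon)
  fix e :: real assume e: "e > 0"
  define z where "z s = y + s *\<^sub>R (x - y)" for s
  \<comment> \<open>The tilt exceeds the slope permitted by \<open>L\<close> by the surplus
    \<open>e\<close>; once the maximizer is shown to be 0, \<open>m 1 \<le> m 0\<close> is the
    claim.\<close>
  define m where "m s = F (z s) - (L * norm (x - y) + e) * s" for s
  have seg: "z s \<in> closed_segment y x" if "s \<in> {0..1}" for s
    using that unfolding closed_segment_def
    by (intro CollectI exI[of _ s]) (auto simp: z_def algebra_simps)
  then have zX: "z s \<in> X" if "s \<in> {0..1}" for s
    using that convex_X x y closed_segment_subset by blast
  have "continuous_on {0..1} (F \<circ> z)"
  proof (rule continuous_on_compose)
    show "continuous_on {0..1} z"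
      unfolding z_def by (intro continuous_intros)
    show "continuous_on (z ` {0..1}) F"
      by (rule continuous_on_subset[OF continuous_F]) (use zX in auto)
  qed
  then have "continuous_on {0..1} m"
    unfolding m_def by (auto intro!: continuous_intros simp: o_def)
  then obtain s where s: "s \<in> {0..1}" and smax: "\<And>s'. s' \<in> {0..1} \<Longrightarrow> m s' \<le> m s"
    using continuous_attains_sup[of "{0..1::real}" m] by auto
  have "s = 0"
  proof (rule ccontr)
    assume "s \<noteq> 0"
    then have s0: "0 < s" using s by auto
    obtain \<zeta> where \<zeta>: "\<zeta> \<in> frechet_subdiff f (z s)"
      using frechet_subdiff_nonempty[OF zX[OF s]] by blast
    have nL: "norm \<zeta> \<le> L"
      using L seg[OF s] \<zeta> by blast
    \<comment> \<open>The remainder uses up at most half of the surplus \<open>e\<close>; the added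
      1 keeps the denominator positive when \<open>x = y\<close>.\<close>
    define \<epsilon> where "\<epsilon> = e / (2 * (norm (x - y) + 1))"
    have n1: "norm (x - y) + 1 > 0"
      using norm_ge_zero[of "x - y"] by linarith
    have \<epsilon>: "\<epsilon> > 0"
      using e n1 by (simp add: \<epsilon>_def)
    have "\<epsilon> * norm (x - y) \<le> \<epsilon> * (norm (x - y) + 1)"
      using \<epsilon> by simp
    also have "\<dots> = e / 2"
      using n1 by (simp add: \<epsilon>_def field_simps)
    finally have \<epsilon>n: "\<epsilon> * norm (x - y) \<le> e / 2" .
    obtain d where d: "d > 0" and near: "\<And>w. w \<noteq> z s \<Longrightarrow> dist w (z s) < d \<Longrightarrow>
        f w \<ge> f (z s) + ereal (\<zeta> \<bullet> (w - z s) - \<epsilon> * norm (w - z s))"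
      using frechet_subdiff_eventually[OF \<zeta> \<epsilon>] unfolding eventually_at by blast
    define u where "u = min s (d / (2 * (norm (x - y) + 1)))"
    have u: "0 < u" "u \<le> s"
      using s0 d n1 by (auto simp: u_def)
    have "u * (norm (x - y) + 1) \<le> d / 2"
    proof -
      have "u \<le> d / (2 * (norm (x - y) + 1))" by (simp add: u_def)
      then show ?thesis using n1 by (simp add: field_simps)
    qed
    then have un: "u * norm (x - y) < d"
      using u d by (simp add: algebra_simps)
    have su: "s - u \<in> {0..1}"
      using s u by auto
    have diff: "z (s - u) - z s = - u *\<^sub>R (x - y)"
      by (simp add: z_def algebra_simps)
    have "F (z (s - u)) \<ge> F (z s) - u * (\<zeta> \<bullet> (x - y)) - \<epsilon> * (u * norm (x - y))"
    \<comment> \<open>The local estimate \<open>near\<close> excludes the base point itself, which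
      is hit when \<open>x = y\<close>.\<close>
    proof (cases "z (s - u) = z s")
      case True
      then show ?thesis using diff u by auto
    next
      case False
      then show ?thesis
        using near[of "z (s - u)"] un u f_eq_X[OF zX[OF s]] f_eq_X[OF zX[OF su]]
        by (simp add: dist_norm diff)
    qed
    moreover have "u * (\<zeta> \<bullet> (x - y)) \<le> u * (L * norm (x - y))"
    proof -
      have "\<zeta> \<bullet> (x - y) \<le> norm \<zeta> * norm (x - y)"
        by (rule norm_cauchy_schwarz)
      also have "\<dots> \<le> L * norm (x - y)"
        using nL by (rule mult_right_mono) simp
      finally show ?thesis using u by simp
    qed
    moreover have "u * (\<epsilon> * norm (x - y)) \<le> u * (e / 2)"
      using \<epsilon>n u by simp
    moreover have "u * e > 0"
      using u e by simp
    ultimately have "m s < m (s - u)"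
      by (simp add: m_def algebra_simps)
    then show False
      using smax[OF su] by simp
  qed
  then show "F x - F y \<le> L * norm (x - y) + e"
    using smax[of 1] by (simp add: m_def z_def)
qed

end

section \<open>Sharp minima\<close>

locale sharp_minimum = rel_weakly_convex h f X \<rho>
  for h f :: "'a::euclidean_space \<Rightarrow> ereal" and X :: "'a set" and \<rho> :: real +
  fixes \<mu> \<nu> G L :: real
  assumes mu_pos: "\<mu> > 0" and nu_pos: "0 < \<nu>" and G_pos: "G > 0" and L_pos: "L > 0"
    and sharpness: "\<forall>z\<in>X. ereal (\<mu> * infdist z (opt_set f X)) \<le> f z - opt_value f X"
    and bregman_growth: "\<forall>z\<in>X. infdist z (opt_set f X) < (\<mu> / (\<rho> * G)) powr (1 / \<nu>) \<longrightarrow>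
          (INF y\<in>proj (opt_set f X) z. bregman h y z)
            \<le> ereal (G * infdist z (opt_set f X) powr (1 + \<nu>))"
    and L_eq: "ereal L =
          Sup {ereal (norm \<zeta>) | \<zeta> z. z \<in> tube f X \<mu> \<rho> G \<nu> 1 \<and> \<zeta> \<in> frechet_subdiff f z}"
begin

abbreviation "d z \<equiv> infdist z (opt_set f X)"

lemma subgradient_norm_le:
  assumes "z \<in> tube f X \<mu> \<rho> G \<nu> 1" "\<zeta> \<in> frechet_subdiff f z"
  shows "norm \<zeta> \<le> L"
proof -
  have "ereal (norm \<zeta>) \<le> ereal L"
    unfolding L_eq using assms by (intro Sup_upper) blast
  then show ?thesis by simp
qed

lemma tube_mono:
  assumes "0 < \<beta>" "\<beta> \<le> 1" "z \<in> tube f X \<mu> \<rho> G \<nu> \<beta>"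
  shows "z \<in> tube f X \<mu> \<rho> G \<nu> 1"
proof -
  have "\<beta> * \<mu> / (\<rho> * G) \<le> 1 * \<mu> / (\<rho> * G)"
    using assms mu_pos G_pos rho_pos by (intro divide_right_mono) auto
  then have "(\<beta> * \<mu> / (\<rho> * G)) powr (1 / \<nu>) \<le> (1 * \<mu> / (\<rho> * G)) powr (1 / \<nu>)"
    using assms mu_pos nu_pos G_pos rho_pos by (intro powr_mono2) auto
  then show ?thesis
    using assms(3) by (auto simp: tube_def)
qed

text \<open>No point of the segment from \<open>z\<close> to a nearest minimizer is farther from the
  minimizers than \<open>z\<close>, so the segment stays in the tube, where \<open>L\<close> bounds
  all subgradients.\<close>

lemma gap_le:
  assumes z: "z \<in> tube f X \<mu> \<rho> G \<nu> 1"
  shows "f z - opt_value f X \<le> ereal (L * d z)"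
proof -
  define y where "y = closest_point (opt_set f X) z"
  have "y \<in> proj (opt_set f X) z"
    unfolding y_def by (rule closest_point_in_proj[OF closed_opt_set opt_nonempty])
  note y = projD[OF this]
  have X: "z \<in> X" "y \<in> X"
    using z y(1) opt_set_subset by (auto simp: tube_def)
  have "F z - F y \<le> L * norm (z - y)"
  proof (rule increase_along_segment[OF X])
    fix w \<zeta> assume w: "w \<in> closed_segment y z" and \<zeta>: "\<zeta> \<in> frechet_subdiff f w"
    have "w \<in> X"
      using w X convex_X closed_segment_subset by blast
    moreover have "d w \<le> d z"
    proof -
      have "d w \<le> dist w y"
        by (rule infdist_le[OF y(1)])
      also have "\<dots> \<le> dist y z"
        using dist_in_closed_segment[OF w] by (simp add: dist_commute)
      finally show ?thesis
        using y(2) by (simp add: dist_commute)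
    qed
    ultimately show "norm \<zeta> \<le> L"
      using z by (intro subgradient_norm_le[OF _ \<zeta>]) (auto simp: tube_def)
  qed
  then show ?thesis
    using y f_eq_X[OF X(1)] f_eq_X[OF X(2)] opt_value_eq[OF y(1)]
    by (metis dist_norm ereal_less_eq(3) ereal_minus(1))
qed

text \<open>The growth condition bounds only an infimum over the nearest minimizers; the slack
  \<open>e\<close> pays for choosing one that nearly attains it, so \<open>y\<close> depends on
  \<open>e\<close>.\<close>

lemma subgradient_angle:
  assumes \<beta>: "0 < \<beta>" "\<beta> < 1" and z: "z \<in> tube f X \<mu> \<rho> G \<nu> \<beta>"
    and \<zeta>: "\<zeta> \<in> frechet_subdiff f z" and e: "e > 0"
  obtains y where "y \<in> opt_set f X" "dist z y = d z" "\<zeta> \<bullet> (z - y) \<ge> (1 - \<beta>) * \<mu> * d z - e"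
proof -
  have zX: "z \<in> X" and dz: "d z < (\<beta> * \<mu> / (\<rho> * G)) powr (1 / \<nu>)"
    using z by (auto simp: tube_def)
  have "d z < (\<mu> / (\<rho> * G)) powr (1 / \<nu>)"
    using tube_mono[OF _ _ z] \<beta> by (simp add: tube_def)
  then have "(INF y\<in>proj (opt_set f X) z. bregman h y z) \<le> ereal (G * d z powr (1 + \<nu>))"
    using bregman_growth zX by blast
  also have "\<dots> < ereal (G * d z powr (1 + \<nu>) + e / \<rho>)"
    using e rho_pos by simp
  finally obtain y where yp: "y \<in> proj (opt_set f X) z"
    and yb: "bregman h y z < ereal (G * d z powr (1 + \<nu>) + e / \<rho>)"
    unfolding INF_less_iff by blast
  note y = projD[OF yp]
  have yX: "y \<in> X"
    using y(1) opt_set_subset by blast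
  let ?D = "H y - H z - grad h z \<bullet> (y - z)"
  have "bregman h y z = ereal ?D"
    using zX yX X_sub by (intro bregman_eq) auto
  then have "?D < G * d z powr (1 + \<nu>) + e / \<rho>"
    using yb by simp
  then have "\<rho> * ?D \<le> \<rho> * (G * d z powr (1 + \<nu>) + e / \<rho>)"
    using rho_pos by simp
  also have "\<dots> = \<rho> * G * d z powr (1 + \<nu>) + e"
    using rho_pos by (simp add: algebra_simps)
  \<comment> \<open>The tube radius is chosen so that the Bregman term consumes at most the fraction
    \<beta> of the sharpness bound.\<close>
  also have "\<rho> * G * d z powr (1 + \<nu>) \<le> \<beta> * \<mu> * d z"
  proof -
    have "d z powr \<nu> \<le> ((\<beta> * \<mu> / (\<rho> * G)) powr (1 / \<nu>)) powr \<nu>"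
      using dz nu_pos by (intro powr_mono2) (auto simp: infdist_nonneg)
    also have "\<dots> = \<beta> * \<mu> / (\<rho> * G)"
      using nu_pos \<beta> mu_pos rho_pos G_pos by (simp add: powr_powr)
    finally have "\<rho> * G * d z powr \<nu> \<le> \<beta> * \<mu>"
      using rho_pos G_pos by (simp add: field_simps)
    then have "d z * (\<rho> * G * d z powr \<nu>) \<le> d z * (\<beta> * \<mu>)"
      by (rule mult_left_mono) (rule infdist_nonneg)
    moreover have "d z powr (1 + \<nu>) = d z * d z powr \<nu>"
      using infdist_nonneg[of z "opt_set f X"] by (cases "d z = 0") (auto simp: powr_add)
    ultimately show ?thesis
      by (simp add: algebra_simps)
  qed
  finally have D: "\<rho> * ?D \<le> \<beta> * \<mu> * d z + e" by simp
  have "\<mu> * d z \<le> F z - F y"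
    using sharpness zX f_eq_X[OF zX] f_eq_X[OF yX] opt_value_eq[OF y(1)]
    by (metis ereal_less_eq(3) ereal_minus(1))
  moreover have "F y \<ge> F z + \<zeta> \<bullet> (y - z) - \<rho> * ?D"
    by (rule subgradient_inequality[OF zX yX \<zeta>])
  moreover have "\<zeta> \<bullet> (y - z) = - (\<zeta> \<bullet> (z - y))"
    by (simp add: inner_diff_right)
  ultimately have "\<zeta> \<bullet> (z - y) \<ge> (1 - \<beta>) * \<mu> * d z - e"
    using D by (simp add: algebra_simps)
  with y that show thesis by blast
qed

lemma step_decrease:
  assumes \<beta>: "0 < \<beta>" "\<beta> < 1" and z: "z \<in> tube f X \<mu> \<rho> G \<nu> \<beta>"
    and \<zeta>: "\<zeta> \<in> frechet_subdiff f z" and \<alpha>: "\<alpha> > 0"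
    and z': "if \<zeta> = 0 then z' = z else z' \<in> proj X (z - (\<alpha> / norm \<zeta>) *\<^sub>R \<zeta>)"
  shows "(d z')\<^sup>2 \<le> (d z)\<^sup>2 - 2 * \<alpha> * ((1 - \<beta>) * (\<mu> / L)) * d z + \<alpha>\<^sup>2"
proof (cases "\<zeta> = 0")
  case True
  \<comment> \<open>A zero subgradient makes the left side of the angle bound vanish, so
    \<open>z\<close> is at distance 0 and staying put is harmless.\<close>
  have "(1 - \<beta>) * \<mu> * d z \<le> 0 + e" if "e > 0" for e
    using subgradient_angle[OF \<beta> z \<zeta> that] True by fastforce
  then have "(1 - \<beta>) * \<mu> * d z \<le> 0"
    by (rule field_le_epsilon)
  then have "d z = 0"
    using \<beta> mu_pos infdist_nonneg[of z "opt_set f X"] by (simp add: mult_le_0_iff)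
  then show ?thesis
    using True z' by simp
next
  case False
  define b where "b = \<alpha> / norm \<zeta>"
  have b: "b > 0" "b * norm \<zeta> = \<alpha>"
    using \<alpha> False by (auto simp: b_def)
  have "(d z')\<^sup>2 \<le> (d z)\<^sup>2 - 2 * b * ((1 - \<beta>) * \<mu> * d z) + \<alpha>\<^sup>2"
  proof (rule field_le_epsilon)
    fix e :: real assume "e > 0"
    then obtain y where y: "y \<in> opt_set f X" "dist z y = d z"
      and angle: "\<zeta> \<bullet> (z - y) \<ge> (1 - \<beta>) * \<mu> * d z - e / (2 * b)"
      \<comment> \<open>The slack is multiplied by \<open>2 * b\<close> when the square is expanded,
        giving exactly \<open>e\<close>.\<close>
      using subgradient_angle[OF \<beta> z \<zeta>, of "e / (2 * b)"] b by auto
    have "d z' \<le> dist z' y"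
      by (rule infdist_le[OF y(1)])
    also have "\<dots> \<le> dist (z - b *\<^sub>R \<zeta>) y"
      using z' False y(1) opt_set_subset
      by (intro proj_nonexpansive[OF convex_X closed_X]) (auto simp: b_def)
    finally have "(d z')\<^sup>2 \<le> (dist (z - b *\<^sub>R \<zeta>) y)\<^sup>2"
      by (rule power_mono) (rule infdist_nonneg)
    also have "\<dots> = (norm ((z - y) - b *\<^sub>R \<zeta>))\<^sup>2"
      by (simp add: dist_norm algebra_simps)
    also have "\<dots> = (norm (z - y))\<^sup>2 - 2 * b * (\<zeta> \<bullet> (z - y)) + (b * norm \<zeta>)\<^sup>2"
      unfolding power_mult_distrib power2_norm_eq_inner
      by (simp add: inner_diff_left inner_diff_right inner_commute power2_eq_square algebra_simps)
    also have "\<dots> = (d z)\<^sup>2 - 2 * b * (\<zeta> \<bullet> (z - y)) + \<alpha>\<^sup>2"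
      using y(2) b(2) by (simp add: dist_norm)
    also have "\<dots> \<le> (d z)\<^sup>2 - (2 * b * ((1 - \<beta>) * \<mu> * d z) - e) + \<alpha>\<^sup>2"
    proof -
      have "2 * b * (\<zeta> \<bullet> (z - y)) \<ge> 2 * b * ((1 - \<beta>) * \<mu> * d z - e / (2 * b))"
        using angle b by simp
      then show ?thesis using b by (simp add: right_diff_distrib)
    qed
    finally show "(d z')\<^sup>2 \<le> (d z)\<^sup>2 - 2 * b * ((1 - \<beta>) * \<mu> * d z) + \<alpha>\<^sup>2 + e"
      by simp
  qed
  \<comment> \<open>Replacing \<open>norm \<zeta>\<close> by its bound \<open>L\<close> in the
    normalized step turns \<mu> into the ratio \<open>\<mu> / L\<close>.\<close>
  moreover have "\<alpha> / L \<le> b"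
    unfolding b_def using subgradient_norm_le[OF tube_mono[OF _ _ z] \<zeta>] \<beta> \<alpha> False L_pos
    by (intro divide_left_mono) auto
  then have "\<alpha> / L * ((1 - \<beta>) * \<mu> * d z) \<le> b * ((1 - \<beta>) * \<mu> * d z)"
    using \<beta> mu_pos by (intro mult_right_mono) (auto simp: infdist_nonneg)
  moreover have "2 * \<alpha> * ((1 - \<beta>) * (\<mu> / L)) * d z = 2 * (\<alpha> / L * ((1 - \<beta>) * \<mu> * d z))"
    by simp
  ultimately show ?thesis
    by linarith
qed

end

section \<open>The rate\<close>

text \<open>A Bernoulli-type bound for \<open>(1 + 1 / t) powr (- 2 * r)\<close>, from
  \<open>ln (1 + u) \<le> u\<close> and \<open>exp u \<ge> 1 + u\<close>.\<close>

lemma powr_shift_lower: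
  fixes t r :: real
  assumes "t > 0" "r > 0"
  shows "((t + 1) powr (- r))\<^sup>2 \<ge> (1 - 2 * r / t) * (t powr (- r))\<^sup>2"
proof -
  have "1 - 2 * r / t \<le> 1 - 2 * r * ln (1 + 1 / t)"
    using ln_add_one_self_le_self[of "1 / t"] assms mult_left_mono[of "ln (1 + 1 / t)" "1 / t" "2 * r"]
    by simp
  also have "\<dots> \<le> exp (- 2 * r * ln (1 + 1 / t))"
    using exp_ge_add_one_self[of "- 2 * r * ln (1 + 1 / t)"] by simp
  also have "\<dots> = (1 + 1 / t) powr (- 2 * r)"
  proof -
    have "1 + 1 / t > 0" using assms by (simp add: add_pos_pos)
    then show ?thesis by (simp add: powr_def)
  qed
  finally have "(1 - 2 * r / t) * t powr (- 2 * r) \<le> (1 + 1 / t) powr (- 2 * r) * t powr (- 2 * r)"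
    by (rule mult_right_mono) simp
  also have "\<dots> = ((1 + 1 / t) * t) powr (- 2 * r)"
    using assms by (subst powr_mult) auto
  also have "(1 + 1 / t) * t = t + 1"
    using assms by (simp add: field_simps)
  finally show ?thesis
    using assms by (simp add: powr_power mult_ac)
qed

text \<open>Induction step for the rate, with \<open>c\<close> standing for
  \<open>(1 - \<beta>) * \<tau>\<close>. The bounds on \<open>t\<close> and \<open>A\<close> are all
  that is used of \<open>k0\<close> and of the square root in \<open>A\<close>.\<close>

lemma rate_step:
  fixes D D' t c lam A r :: real
  assumes D: "0 \<le> D" "D \<le> A * t powr (- r)"
    and D': "D'\<^sup>2 \<le> D\<^sup>2 - 2 * (lam * t powr (- r)) * c * D + (lam * t powr (- r))\<^sup>2"
    and t: "t \<ge> 1" "t \<ge> 2 * r * A / (c * lam)" and pos: "c > 0" "lam > 0" "r > 0"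
    and A: "A \<ge> 2 powr r * lam" "A \<ge> lam / c"
  shows "D' \<le> A * (t + 1) powr (- r)"
proof -
  define p where "p = t powr (- r)"
  define q where "q = (t + 1) powr (- r)"
  have p: "p > 0" and q: "q > 0"
    using t by (auto simp: p_def q_def)
  have A0: "A > 0"
  proof -
    have "2 powr r * lam > 0" using pos by simp
    then show ?thesis using A(1) by linarith
  qed
  \<comment> \<open>The end \<open>D = 0\<close>: since \<open>t + 1 \<le> 2 * t\<close>, the factor
    \<open>2 powr r\<close> in \<open>A\<close> absorbs the shift of the index.\<close>
  have zero_end: "(lam * p)\<^sup>2 \<le> (A * q)\<^sup>2"
  proof (rule power_mono)
    have "2 powr (- r) * p = (2 * t) powr (- r)"
      using t by (simp add: p_def powr_mult)
    also have "\<dots> \<le> q"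
      unfolding q_def using t pos by (intro powr_mono2') auto
    finally have "(2 powr r * lam) * (2 powr (- r) * p) \<le> A * q"
      using A A0 p q by (intro mult_mono) auto
    then show "lam * p \<le> A * q"
      by (simp add: powr_minus field_simps)
  qed (use pos p in simp)
  \<comment> \<open>The end \<open>D = A * p\<close>: \<open>lam \<le> A * c\<close> lets half of
    the decrease absorb the squared step, and the bound on \<open>t\<close> makes the other half at
    least \<open>A\<^sup>2 * (2 * r / t)\<close>.\<close>
  have far_end: "(A * p)\<^sup>2 - 2 * (lam * p) * c * (A * p) + (lam * p)\<^sup>2 \<le> (A * q)\<^sup>2"
  proof -
    have "2 * r * A / t \<le> c * lam"
      using t pos by (simp add: field_simps)
    then have "A * (2 * r * A / t) \<le> A * (c * lam)"
      using A0 by (intro mult_left_mono) auto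
    moreover have "lam * lam \<le> lam * (A * c)"
      using A(2) pos by (intro mult_left_mono) (auto simp: field_simps)
    ultimately have "A\<^sup>2 - 2 * lam * c * A + lam\<^sup>2 \<le> A\<^sup>2 * (1 - 2 * r / t)"
      by (simp add: power2_eq_square algebra_simps)
    then have "(A\<^sup>2 - 2 * lam * c * A + lam\<^sup>2) * p\<^sup>2 \<le> A\<^sup>2 * (1 - 2 * r / t) * p\<^sup>2"
      by (rule mult_right_mono) simp
    also have "\<dots> = A\<^sup>2 * ((1 - 2 * r / t) * p\<^sup>2)"
      by simp
    also have "\<dots> \<le> A\<^sup>2 * q\<^sup>2"
      using powr_shift_lower[of t r] t pos by (intro mult_left_mono) (auto simp: p_def q_def)
    finally show ?thesis
      by (simp add: power2_eq_square algebra_simps)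
  qed
  have "D'\<^sup>2 \<le> (A * q)\<^sup>2"
  \<comment> \<open>The quadratic part \<open>D * (D - 2 * (lam * p) * c)\<close> is at most its
    value 0 at \<open>D = 0\<close> in the first case and increases with \<open>D\<close> in the
    second, so one of the two ends dominates.\<close>
  proof (cases "D \<le> 2 * (lam * p) * c")
    case True
    then have "D * D \<le> 2 * (lam * p) * c * D"
      using D(1) by (rule mult_right_mono)
    then show ?thesis
      using D' zero_end by (simp add: p_def power2_eq_square)
  next
    case False
    then have "D * (D - 2 * (lam * p) * c) \<le> (A * p) * (A * p - 2 * (lam * p) * c)"
      using D by (intro mult_mono) (auto simp: p_def)
    then show ?thesis
      using D' far_end by (simp add: p_def power2_eq_square algebra_simps)
  qed
  then have "D' \<le> A * q"
    by (rule power2_le_imp_le) (use A0 q in simp)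
  then show ?thesis by (simp add: q_def)
qed

section \<open>Propagation of the rate along the iterates\<close>

theorem theorem4p8:
  fixes h f :: "real ^ 'n \<Rightarrow> ereal"
    and X :: "(real ^ 'n) set"
    and \<rho> \<mu> \<nu> G L \<tau> \<beta> r lam A k0 :: real
    and x :: "nat \<Rightarrow> real ^ 'n"
  assumes "legendre_kernel h"
    and "X \<noteq> {}" and "closed X" and "convex X" and "X \<subseteq> interior (eff_dom h)"
    and "proper_fun f"
    and "\<rho> > 0"
    and "ereal_convex_on (interior (eff_dom h)) (\<lambda>z. f z + ereal \<rho> * h z)"
    and "\<forall>z\<in>X. finite_locally_lipschitz_at f z"
    and "opt_value f X > -\<infinity>"
    and "opt_set f X \<noteq> {}"
    and "\<mu> > 0"
    and sharp: "\<forall>z\<in>X. ereal (\<mu> * infdist z (opt_set f X)) \<le> f z - opt_value f X"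
    and "0 < \<nu>" and "\<nu> \<le> 1" and "G > 0"
    and growth: "\<forall>z\<in>X. infdist z (opt_set f X) < (\<mu> / (\<rho> * G)) powr (1 / \<nu>) \<longrightarrow>
          (INF y\<in>proj (opt_set f X) z. bregman h y z)
            \<le> ereal (G * infdist z (opt_set f X) powr (1 + \<nu>))"
    and "ereal L = Sup {ereal (norm \<zeta>) | \<zeta> z. z \<in> tube f X \<mu> \<rho> G \<nu> 1 \<and> \<zeta> \<in> frechet_subdiff f z}"
    and "L > 0"
    and "\<tau> = \<mu> / L"
    and "0 < \<beta>" and "\<beta> < 1" and "0 < r" and "r < 1" and "lam > 0"
    and "A = 2 powr r * lam * sqrt (1 / ((1 - \<beta>)\<^sup>2 * \<tau>\<^sup>2) + 1)"
    and "k0 = Max {2 * r * A / ((1 - \<beta>) * lam * \<tau>),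
                   A powr (1 / r) * (\<rho> * G / (\<beta> * \<mu>)) powr (1 / (r * \<nu>)),
                   1}"
    and "psga f X (\<lambda>k. lam * (real k + k0) powr (- r)) x"
    and "x 0 \<in> tube f X \<mu> \<rho> G \<nu> \<beta>"
    and "infdist (x 0) (opt_set f X) \<le> A * k0 powr (- r)"
  shows "\<forall>k. infdist (x k) (opt_set f X) \<le> A / (real k + k0) powr r \<and>
             f (x k) - opt_value f X \<le> ereal (L * A / (real k + k0) powr r)"
proof -
  interpret sharp_minimum h f X \<rho> \<mu> \<nu> G L
    by unfold_locales (use assms in auto)
  define c where "c = (1 - \<beta>) * \<tau>"
  have \<tau>: "\<tau> > 0" and c: "c > 0"
    using assms by (auto simp: c_def)
  \<comment> \<open>The two summands under the root give one lower bound each: 1 for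
    \<open>A1\<close>, which serves the near end, and \<open>1 / c\<close> for \<open>A2\<close>,
    which serves the far end.\<close>
  have s1: "sqrt (1 / ((1 - \<beta>)\<^sup>2 * \<tau>\<^sup>2) + 1) \<ge> 1"
    by (rule real_le_rsqrt) simp
  have "1 / c \<le> sqrt (1 / c\<^sup>2 + 1)"
    by (rule real_le_rsqrt) (simp add: power_divide)
  then have s2: "sqrt (1 / ((1 - \<beta>)\<^sup>2 * \<tau>\<^sup>2) + 1) \<ge> 1 / c"
    by (simp add: c_def power_mult_distrib)
  have A1: "A \<ge> 2 powr r * lam"
    using s1 \<open>lam > 0\<close> unfolding \<open>A = _\<close> by simp
  have A2: "A \<ge> lam / c"
  proof -
    have "2 powr r \<ge> (1::real)"
      using \<open>0 < r\<close> by (simp add: ge_one_powr_ge_zero)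
    then have "1 * lam * (1 / c) \<le> A"
      unfolding \<open>A = _\<close> using s2 \<open>lam > 0\<close> c by (intro mult_mono) auto
    then show ?thesis by simp
  qed
  have A0: "A > 0"
    using A2 \<open>lam > 0\<close> c by (meson divide_pos_pos less_le_trans)
  have k1: "k0 \<ge> 1" and k2: "k0 \<ge> 2 * r * A / (c * lam)"
    and k3: "k0 \<ge> A powr (1 / r) * (\<rho> * G / (\<beta> * \<mu>)) powr (1 / (r * \<nu>))"
    unfolding \<open>k0 = _\<close> by (auto simp: c_def mult_ac)
  \<comment> \<open>The second entry of the maximum defining \<open>k0\<close>, raised to the power
    \<open>r\<close>, says that the initial rate bound fits into the tube.\<close>
  have tube_radius: "A * k0 powr (- r) \<le> (\<beta> * \<mu> / (\<rho> * G)) powr (1 / \<nu>)"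
  proof -
    define w where "w = \<beta> * \<mu> / (\<rho> * G)"
    have w: "w > 0" "\<rho> * G / (\<beta> * \<mu>) = inverse w"
      using assms by (auto simp: w_def)
    have "(A powr (1 / r) * inverse w powr (1 / (r * \<nu>))) powr r \<le> k0 powr r"
      using k3 \<open>0 < r\<close> unfolding w(2) by (intro powr_mono2) auto
    also have "(A powr (1 / r) * inverse w powr (1 / (r * \<nu>))) powr r
        = A * inverse w powr (1 / \<nu>)"
      using A0 w \<open>0 < r\<close> by (simp add: powr_mult powr_powr)
    also have "inverse w powr (1 / \<nu>) = inverse (w powr (1 / \<nu>))"
      using w(1) by (simp add: inverse_powr)
    finally have "A \<le> k0 powr r * w powr (1 / \<nu>)"
      using w(1) by (simp add: field_simps)
    moreover have "k0 powr r > 0"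
      using k1 by simp
    ultimately show ?thesis
      unfolding w_def[symmetric] powr_minus by (simp add: field_simps)
  qed
  \<comment> \<open>Tube membership joins the induction because the one-step decrease holds only in
    the tube.\<close>
  have main: "x k \<in> tube f X \<mu> \<rho> G \<nu> \<beta> \<and> d (x k) \<le> A * (real k + k0) powr (- r)" for k
  proof (induction k)
    case 0
    then show ?case using assms by simp
  next
    case (Suc k)
    obtain \<zeta> where \<zeta>: "\<zeta> \<in> frechet_subdiff f (x k)"
      and step: "if \<zeta> = 0 then x (Suc k) = x k
        else x (Suc k) \<in> proj X (x k - (lam * (real k + k0) powr (- r) / norm \<zeta>) *\<^sub>R \<zeta>)"
      using \<open>psga _ _ _ _\<close> unfolding psga_def by blast
    have "x (Suc k) \<in> X"
      using step Suc projD(1) by (auto simp: tube_def split: if_splits)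
    moreover have rate: "d (x (Suc k)) \<le> A * ((real k + k0) + 1) powr (- r)"
    proof (rule rate_step)
      show "(d (x (Suc k)))\<^sup>2 \<le> (d (x k))\<^sup>2 - 2 * (lam * (real k + k0) powr (- r)) * c * d (x k)
          + (lam * (real k + k0) powr (- r))\<^sup>2"
        unfolding c_def \<open>\<tau> = _\<close>
        by (rule step_decrease[OF _ _ _ \<zeta> _ step]) (use assms Suc k1 in auto)
    qed (use Suc k1 k2 c A1 A2 \<open>lam > 0\<close> \<open>0 < r\<close> in \<open>auto simp: infdist_nonneg\<close>)
    \<comment> \<open>The tube is defined by a strict inequality while \<open>tube_radius\<close> is
      not strict; strictness comes from the index having grown.\<close>
    moreover have "A * ((real k + k0) + 1) powr (- r) < A * k0 powr (- r)"
      using A0 k1 \<open>0 < r\<close> by (intro mult_strict_left_mono powr_less_mono2_neg) auto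
    ultimately show ?case
      using tube_radius by (auto simp: tube_def algebra_simps)
  qed
  show ?thesis
  proof (intro allI conjI)
    fix k
    show rate: "d (x k) \<le> A / (real k + k0) powr r"
      using main[of k] by (simp add: powr_minus divide_inverse)
    have "f (x k) - opt_value f X \<le> ereal (L * d (x k))"
      using gap_le[OF tube_mono] main[of k] \<open>0 < \<beta>\<close> \<open>\<beta> < 1\<close> by (metis less_imp_le)
    also have "\<dots> \<le> ereal (L * A / (real k + k0) powr r)"
      using mult_left_mono[OF rate, of L] \<open>L > 0\<close> by simp
    finally show "f (x k) - opt_value f X \<le> ereal (L * A / (real k + k0) powr r)" .
  qed
qed

end
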